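(* Let $V_3,V_4,\dots$ be independent random variables with $V_m\sim\mathrm{Bern}\big(\frac1m\big)$, $m\ge3$. Then, for $n\ge2$ and $d\ge0$, $$p_{\mathrm{br}}(n,d)=\mathbb{P}\Big(\sum_{m=3}^nV_m\ge d\Big).$$ Consequently, for $n\ge3$ and $d\ge1$, $$p_{\mathrm{br}}(n,d)=\frac{n-1}{n}\,p_{\mathrm{br}}(n-1,d)+\frac1n\,p_{\mathrm{br}}(n-1,d-1).$$ Together with the boundary conditions $p_{\mathrm{br}}(n,0)=1$ for all $n\ge2$ and $p_{\mathrm{br}}(2,d)=0$ for all $d\ge1$, this recurrence uniquely determines the array $(p_{\mathrm{br}}(n,d))_{n\ge2,d\ge0}$.
   Context: The array is defined by $$p_{\mathrm{br}}(n,d):=\frac{2}{n!}\sum_{r\ge0}c(n,d+2+2r),\qquad n\ge2,\ d\ge0,$$ where the unsigned Stirling numbers of the first kind $c(n,k)$, $k\in\mathbb{Z}$, are defined by $\sum_{k\in\mathbb{Z}}c(n,k)x^k=x(x+1)\cdots(x+n-1)$ (so $c(n,k)=0$ for $k\notin\{0,\dots,n\}$). An empty sum is zero. $\mathrm{Bern}(p)$ is the Bernoulli distribution on $\{0,1\}$ with success probability $p$. *)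

theory Defs
  imports
    "HOL-Probability.Probability"
    "HOL-Combinatorics.Stirling"
    "HOL-Computational_Algebra.Polynomial"
begin

text \<open>
  The library's \<^const>\<open>stirling\<close> is the array of unsigned Stirling numbers of the first kind:
  \<open>stirling n k\<close> is the coefficient of \<open>x ^ k\<close> in \<open>x (x + 1) \<cdots> (x + n - 1)\<close>.
  Only indices \<open>k \<ge> 2\<close> are used below, so natural-number indices suffice.
\<close>

lemma coeff_rising_factorial_poly:
  "coeff (\<Prod>i<n. [:int i, 1:]) k = int (stirling n k)"
proof (induction n arbitrary: k)
  case 0
  show ?case by (cases k) auto
next
  case (Suc n)
  show ?case
  proof (cases k)
    case 0
    then show ?thesis using Suc.IH[of 0]
      by (cases n) (auto simp: mult.commute)
  next
    case (Suc j)
    then show ?thesis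
      by (simp add: mult.commute[of _ "[:int n, 1:]"] Suc.IH)
  qed
qed

definition p_br :: "nat \<Rightarrow> nat \<Rightarrow> real" where
  "p_br n d = 2 / fact n * (\<Sum>r. real (stirling n (d + 2 + 2 * r)))"

text \<open>The series has finite support, so the sum is a genuine finite one.\<close>

lemma p_br_series:
  "(\<lambda>r. real (stirling n (d + 2 + 2 * r))) sums
     (\<Sum>r | d + 2 + 2 * r \<le> n. real (stirling n (d + 2 + 2 * r)))"
  by (rule sums_finite, rule finite_subset[of _ "{..n}"]) auto

lemma p_br_finite:
  "p_br n d = 2 / fact n * (\<Sum>r | d + 2 + 2 * r \<le> n. real (stirling n (d + 2 + 2 * r)))"
  by (simp only: p_br_def sums_unique[OF p_br_series])

text \<open>The library's \<^const>\<open>bernoulli_pmf\<close> lives on \<^typ>\<open>bool\<close>; this is its copy on \<open>{0, 1}\<close>.\<close>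

definition bern :: "real \<Rightarrow> nat pmf" where
  "bern p = map_pmf of_bool (bernoulli_pmf p)"

end

theory Submission
  imports Defs
begin

text \<open>
  Both sides satisfy the same recurrence and the same boundary conditions. For \<open>p_br\<close> the
  recurrence is the Stirling recurrence summed along a parity class; the boundary value at
  \<open>d = 0\<close> says that the even and the odd indices contribute \<open>n! / 2\<close> each. For the tail
  probabilities it is obtained by conditioning on the last variable.
\<close>

text \<open>The start \<open>k\<close> is arbitrary, not just \<open>d + 2\<close>, because the
  boundary value at \<open>d = 0\<close> is proved by an induction that also visits the tails from 1
  and from 0.\<close>

definition stirling_tail :: "nat \<Rightarrow> nat \<Rightarrow> real" where
  "stirling_tail n k = (\<Sum>r. real (stirling n (k + 2 * r)))"

lemma summable_stirling_tail: "summable (\<lambda>r. real (stirling n (k + 2 * r)))"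
  by (rule summable_finite[of "{..n}"]) auto

text \<open>Starting at \<open>Suc k\<close> keeps every index positive, so the Stirling recurrence
  applies to each term, and summability allows the series to be split.\<close>

lemma stirling_tail_Suc:
  "stirling_tail (Suc n) (Suc k) = real n * stirling_tail n (Suc k) + stirling_tail n k"
proof -
  have "stirling_tail (Suc n) (Suc k)
      = (\<Sum>r. real n * real (stirling n (Suc k + 2 * r)) + real (stirling n (k + 2 * r)))"
    unfolding stirling_tail_def by simp
  also have "\<dots> = real n * stirling_tail n (Suc k) + stirling_tail n k"
    unfolding stirling_tail_def
    by (simp only: suminf_add[symmetric] suminf_mult summable_mult summable_stirling_tail)
  finally show ?thesis .
qed

lemma stirling_tail_split:
  "stirling_tail n k = real (stirling n k) + stirling_tail n (k + 2)"
  using suminf_split_head[OF summable_stirling_tail[of n k]]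
  by (simp add: stirling_tail_def algebra_simps)

lemma stirling_tail_eq_0: "n < k \<Longrightarrow> stirling_tail n k = 0"
  by (simp add: stirling_tail_def)

text \<open>The rising factorial takes the value n! at 1 and vanishes at -1 once n \<ge> 2, so the
  odd and even indices share n! equally. The two halves feed each other in the recurrence, hence the
  joint induction: each step gives (n + 1) n!/2.\<close>

lemma stirling_tail_1_2:
  assumes "n \<ge> 2"
  shows "stirling_tail n 1 = fact n / 2 \<and> stirling_tail n 2 = fact n / 2"
  using assms
proof (induction n rule: dec_induct)
  case base
  show ?case
    using stirling_tail_split[of 2 1] stirling_tail_split[of 2 2]
    by (simp add: stirling_tail_eq_0 numeral_2_eq_2)
next
  case (step n)
  \<comment> \<open>For n > 0 the head \<open>stirling n 0\<close> is 0, so the tail from 0 is again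
    the even half.\<close>
  have "stirling_tail n 0 = stirling_tail n 2"
    using stirling_tail_split[of n 0] step.hyps by (cases n) (simp_all add: numeral_2_eq_2)
  then show ?case
    using stirling_tail_Suc[of n 0] stirling_tail_Suc[of n 1] step.IH
    by (simp add: numeral_2_eq_2 field_simps)
qed

lemma p_br_eq_stirling_tail: "p_br n d = 2 / fact n * stirling_tail n (d + 2)"
  by (simp add: p_br_def stirling_tail_def)

text \<open>Normalising by (n + 1)! instead of n! divides the weights n and 1 of the Stirling
  recurrence by n + 1, which makes them Bernoulli weights.\<close>

lemma p_br_Suc_Suc:
  "p_br (Suc n) (Suc d)
     = real n / real (Suc n) * p_br n (Suc d) + 1 / real (Suc n) * p_br n d"
  using stirling_tail_Suc[of n "d + 2"]
  by (simp add: p_br_eq_stirling_tail field_simps del: of_nat_Suc)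

lemma p_br_recurrence:
  assumes "n \<ge> 1" and "d \<ge> 1"
  shows "p_br n d = (real n - 1) / real n * p_br (n - 1) d + 1 / real n * p_br (n - 1) (d - 1)"
  using p_br_Suc_Suc[of "n - 1" "d - 1"] assms by (simp add: of_nat_diff)

lemma p_br_0_right: "n \<ge> 2 \<Longrightarrow> p_br n 0 = 1"
  using stirling_tail_1_2[of n] by (simp add: p_br_eq_stirling_tail numeral_2_eq_2)

lemma p_br_eq_0: "n < d + 2 \<Longrightarrow> p_br n d = 0"
  by (simp add: p_br_eq_stirling_tail stirling_tail_eq_0)

text \<open>Used twice: for the uniqueness claim, and to identify the tail probabilities with
  \<open>p_br\<close>. Row n + 1 needs row n at both d and d - 1, so d stays arbitrary in the
  induction.\<close>

lemma p_br_unique: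
  fixes q :: "nat \<Rightarrow> nat \<Rightarrow> real"
  assumes rec: "\<And>n d. n \<ge> 3 \<Longrightarrow> d \<ge> 1 \<Longrightarrow>
      q n d = (real n - 1) / real n * q (n - 1) d + 1 / real n * q (n - 1) (d - 1)"
    and q_0: "\<And>n. n \<ge> 2 \<Longrightarrow> q n 0 = 1"
    and q_2: "\<And>d. d \<ge> 1 \<Longrightarrow> q 2 d = 0"
    and "n \<ge> 2"
  shows "q n d = p_br n d"
  using \<open>n \<ge> 2\<close>
proof (induction n arbitrary: d rule: dec_induct)
  case base
  show ?case
    by (cases "d = 0") (simp_all add: q_0 p_br_0_right q_2 p_br_eq_0)
next
  case (step n)
  show ?case
  proof (cases "d = 0")
    case True
    then show ?thesis using step.hyps by (simp add: q_0 p_br_0_right)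
  next
    case False
    then show ?thesis
      using rec[of "Suc n" d] p_br_recurrence[of "Suc n" d] step.hyps
      by (simp add: step.IH)
  qed
qed

text \<open>If X = 0, then Y alone must reach d + 1; if X = 1, reaching d suffices. Independence
  factors the probability of each case.\<close>

lemma (in prob_space) prob_add_bern_ge_Suc:
  fixes X Y :: "'a \<Rightarrow> nat"
  assumes indep: "indep_var (count_space UNIV) X (count_space UNIV) Y"
    and X: "distr M (count_space UNIV) X = measure_pmf (bern p)"
    and p: "0 \<le> p" "p \<le> 1"
  shows "\<P>(\<omega> in M. Suc d \<le> X \<omega> + Y \<omega>)
    = (1 - p) * \<P>(\<omega> in M. Suc d \<le> Y \<omega>) + p * \<P>(\<omega> in M. d \<le> Y \<omega>)"
proof -
  have [measurable]: "X \<in> measurable M (count_space UNIV)" "Y \<in> measurable M (count_space UNIV)"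
    using indep by (auto dest: indep_var_rv1 indep_var_rv2)
  have [measurable]: "(\<lambda>\<omega>. X \<omega> + Y \<omega>) \<in> measurable M (count_space UNIV)"
    by (rule measurable_compose_countable[where f = "\<lambda>k \<omega>. k + Y \<omega>" and g = X]) measurable
  have prob_X: "\<P>(\<omega> in M. X \<omega> = k) = pmf (bern p) k" for k
  proof -
    have "pmf (bern p) k = measure (distr M (count_space UNIV) X) {k}"
      by (simp add: X measure_pmf_single)
    also have "\<dots> = \<P>(\<omega> in M. X \<omega> = k)"
      by (simp add: measure_distr vimage_def Int_def conj_commute)
    finally show ?thesis ..
  qed
  have inj: "inj (of_bool :: bool \<Rightarrow> nat)"
    by (rule injI) (simp split: if_splits add: of_bool_def)
  have pmf_bern: "pmf (bern p) 0 = 1 - p" "pmf (bern p) 1 = p"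
    using pmf_map_inj'[OF inj, of "bernoulli_pmf p" False]
      pmf_map_inj'[OF inj, of "bernoulli_pmf p" True] p
    by (simp_all add: bern_def)
  have joint: "\<P>(\<omega> in M. X \<omega> = k \<and> e \<le> Y \<omega>) = pmf (bern p) k * \<P>(\<omega> in M. e \<le> Y \<omega>)" for k e
    using indep_varD[OF indep, of "{k}" "{e..}"]
    by (simp add: prob_X[symmetric] vimage_def Int_def conj_commute)
  \<comment> \<open>The law of X only forces values in {0, 1} almost surely, so the event agrees
    with the disjoint union of the two cases up to a null set.\<close>
  have "AE k in distr M (count_space UNIV) X. k \<in> {0, 1}"
    unfolding X by (auto simp: AE_measure_pmf_iff bern_def)
  then have "AE \<omega> in M. X \<omega> \<in> {0, 1}"
    by (subst (asm) AE_distr_iff) auto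
  then have "\<P>(\<omega> in M. Suc d \<le> X \<omega> + Y \<omega>)
      = prob ({\<omega>\<in>space M. X \<omega> = 0 \<and> Suc d \<le> Y \<omega>} \<union> {\<omega>\<in>space M. X \<omega> = 1 \<and> d \<le> Y \<omega>})"
    by (intro measure_eq_AE) auto
  also have "\<dots> = \<P>(\<omega> in M. X \<omega> = 0 \<and> Suc d \<le> Y \<omega>) + \<P>(\<omega> in M. X \<omega> = 1 \<and> d \<le> Y \<omega>)"
    by (intro finite_measure_Union) auto
  also have "\<dots> = (1 - p) * \<P>(\<omega> in M. Suc d \<le> Y \<omega>) + p * \<P>(\<omega> in M. d \<le> Y \<omega>)"
    by (simp only: joint pmf_bern)
  finally show ?thesis .
qed

text \<open>\<open>indep_vars_sum\<close> concerns real random variables. The family is therefore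
  embedded into the reals and brought back by the measurable map x \<mapsto> nat
  \<lfloor>x\<rfloor>, a left inverse of the embedding.\<close>

lemma (in prob_space) indep_var_sum_nat:
  fixes V :: "'i \<Rightarrow> 'a \<Rightarrow> nat"
  assumes indep: "indep_vars (\<lambda>_. count_space UNIV) V (insert i I)"
    and "finite I" "i \<notin> I"
  shows "indep_var (count_space UNIV) (V i) (count_space UNIV) (\<lambda>\<omega>. \<Sum>j\<in>I. V j \<omega>)"
proof -
  have "indep_vars (\<lambda>_. borel) (\<lambda>j \<omega>. real (V j \<omega>)) (insert i I)"
    by (rule indep_vars_compose2[OF indep]) simp
  then have "indep_var borel (\<lambda>\<omega>. real (V i \<omega>)) borel (\<lambda>\<omega>. \<Sum>j\<in>I. real (V j \<omega>))"
    by (intro indep_vars_sum assms)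
  then have "indep_var
      (count_space UNIV) ((\<lambda>x. nat \<lfloor>x\<rfloor>) \<circ> (\<lambda>\<omega>. real (V i \<omega>)))
      (count_space UNIV) ((\<lambda>x. nat \<lfloor>x\<rfloor>) \<circ> (\<lambda>\<omega>. \<Sum>j\<in>I. real (V j \<omega>)))"
    by (rule indep_var_compose) measurable
  then show ?thesis
    by (simp add: comp_def flip: of_nat_sum)
qed

lemma (in prob_space) p_br_eq_prob:
  fixes V :: "nat \<Rightarrow> 'a \<Rightarrow> nat"
  assumes indep: "indep_vars (\<lambda>_. count_space UNIV) V {3..}"
    and V: "\<And>m. m \<ge> 3 \<Longrightarrow> distr M (count_space UNIV) (V m) = measure_pmf (bern (1 / real m))"
    and "n \<ge> 2"
  shows "p_br n d = \<P>(\<omega> in M. d \<le> (\<Sum>m=3..n. V m \<omega>))"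
proof -
  define q where "q = (\<lambda>n d. \<P>(\<omega> in M. d \<le> (\<Sum>m=3..n. V m \<omega>)))"
  have "q n d = p_br n d"
  proof (rule p_br_unique)
    fix n d :: nat
    assume n: "n \<ge> 3" and d: "d \<ge> 1"
    have "indep_var (count_space UNIV) (V n) (count_space UNIV) (\<lambda>\<omega>. \<Sum>m=3..n - 1. V m \<omega>)"
      using n by (intro indep_var_sum_nat indep_vars_subset[OF indep]) auto
    moreover have "{3..n} = insert n {3..n - 1}"
      using n by auto
    then have "(\<Sum>m=3..n. V m \<omega>) = V n \<omega> + (\<Sum>m=3..n - 1. V m \<omega>)" for \<omega>
      using n by simp
    \<comment> \<open>Here p = 1/n, so 1 - p = (n - 1)/n; since d \<ge> 1,
      \<open>Suc (d - 1)\<close> is d.\<close>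
    ultimately show "q n d
        = (real n - 1) / real n * q (n - 1) d + 1 / real n * q (n - 1) (d - 1)"
      using prob_add_bern_ge_Suc[OF _ V[OF n], of "\<lambda>\<omega>. \<Sum>m=3..n - 1. V m \<omega>" "d - 1"] n d
      by (simp add: q_def diff_divide_distrib)
  \<comment> \<open>The boundary values: d = 0 gives the whole space, and for n = 2 the sum over the
    empty range \<open>{3..2}\<close> is 0, which never reaches d \<ge> 1.\<close>
  qed (use \<open>n \<ge> 2\<close> in \<open>simp_all add: q_def prob_space\<close>)
  then show ?thesis
    by (simp add: q_def)
qed

theorem proposition22:
  shows "(\<forall>(M :: 'a measure) (V :: nat \<Rightarrow> 'a \<Rightarrow> nat).
            prob_space M \<and>
            prob_space.indep_vars M (\<lambda>_. count_space UNIV) V {3..} \<and>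
            (\<forall>m\<ge>3. distr M (count_space UNIV) (V m) = measure_pmf (bern (1 / real m)))
          \<longrightarrow> (\<forall>n\<ge>2. \<forall>d. p_br n d = \<P>(\<omega> in M. (\<Sum>m=3..n. V m \<omega>) \<ge> d)))
       \<and> (\<forall>n\<ge>3. \<forall>d\<ge>1. p_br n d =
            (real n - 1) / real n * p_br (n - 1) d + 1 / real n * p_br (n - 1) (d - 1))
       \<and> (\<forall>n\<ge>2. p_br n 0 = 1)
       \<and> (\<forall>d\<ge>1. p_br 2 d = 0)
       \<and> (\<forall>q :: nat \<Rightarrow> nat \<Rightarrow> real.
            (\<forall>n\<ge>3. \<forall>d\<ge>1. q n d =
               (real n - 1) / real n * q (n - 1) d + 1 / real n * q (n - 1) (d - 1)) \<and>
            (\<forall>n\<ge>2. q n 0 = 1) \<and>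
            (\<forall>d\<ge>1. q 2 d = 0)
          \<longrightarrow> (\<forall>n\<ge>2. \<forall>d. q n d = p_br n d))"
proof (intro conjI allI impI)
  fix M :: "'a measure" and V :: "nat \<Rightarrow> 'a \<Rightarrow> nat" and n d :: nat
  assume "prob_space M \<and>
      prob_space.indep_vars M (\<lambda>_. count_space UNIV) V {3..} \<and>
      (\<forall>m\<ge>3. distr M (count_space UNIV) (V m) = measure_pmf (bern (1 / real m)))"
    and "n \<ge> 2"
  then show "p_br n d = \<P>(\<omega> in M. d \<le> (\<Sum>m=3..n. V m \<omega>))"
    using prob_space.p_br_eq_prob by blast
next
  fix n d :: nat
  assume "n \<ge> 3" "d \<ge> 1"
  then show "p_br n d
      = (real n - 1) / real n * p_br (n - 1) d + 1 / real n * p_br (n - 1) (d - 1)"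
    by (intro p_br_recurrence) simp_all
next
  fix q :: "nat \<Rightarrow> nat \<Rightarrow> real" and n d :: nat
  assume "(\<forall>n\<ge>3. \<forall>d\<ge>1. q n d =
        (real n - 1) / real n * q (n - 1) d + 1 / real n * q (n - 1) (d - 1)) \<and>
      (\<forall>n\<ge>2. q n 0 = 1) \<and> (\<forall>d\<ge>1. q 2 d = 0)"
    and "n \<ge> 2"
  then show "q n d = p_br n d"
    by (intro p_br_unique) blast+
qed (simp_all add: p_br_0_right p_br_eq_0)

end
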